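(* Let $\mathcal{F}$ be the set of admissible marked graph diagrams, and let $(A;*,\bullet,\{a_n\})$ be a marked Kauffman bracket magma satisfying the three conditions: (1) $a_n=a_{n+2}$ for all $n\in\mathbb{N}$; (2) $a_{n+1}\bullet a_n=a_n=a_n\bullet a_{n+1}$ for all $n\in\mathbb{N}$; (3) $(a*b)\bullet(c*d)=(a\bullet c)*(b\bullet d)$ for all $a,b,c,d\in A$. Then $P_M:\mathcal{F}\to A$ is invariant under all Yoshikawa moves except $\Gamma_1$.
   Context: Algebra. $\mathbb{N}=\{1,2,3,\dots\}$. A magma $(A;\star)$ is entropic if $(a\star b)\star(c\star d)=(a\star c)\star(b\star d)$ for all $a,b,c,d\in A$. A Kauffman bracket magma $(A;*,\{a_n\})$ is an entropic magma $(A;* )$ with a sequence $\{a_n\}_{n=1}^\infty$ in $A$ such that for all $n\in\mathbb{N}$: $(a_{n+1}*a_{n+2})*(a_n*a_{n+1})=a_n$ and $(a_n*a_{n+1})*(a_{n+1}*a_n)=a_{n+1}$. A marked Kauffman bracket magma $(A;*,\bullet,\{a_n\})$ is a Kauffman bracket magma $(A;*,\{a_n\})$ with a further binary operation $\bullet$ on $A$ such that $(A;\bullet)$ is entropic. The invariant $P$. For an unoriented link diagram $D$ with a chosen crossing, $D_0$ is the result of the $A$-smoothing (joining the two regions swept out when the overstrand is rotated counterclockwise) and $D_\infty$ that of the other smoothing. By a theorem of Niebrzydowski–Przytycki, there is a unique $A$-valued function $P$ of unoriented link diagrams, invariant under planar isotopy and Reidemeister moves II and III, with $P(T_n)=a_n$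 for the crossingless diagram $T_n$ with $n$ components and $P(D)=P(D_0)*P(D_\infty)$ at every crossing. Marked graph diagrams. A marked graph diagram is a link diagram in $\mathbb{R}^2$ that may in addition have 4-valent marked vertices, each decorated by a marker, a short segment through the vertex lying in two opposite of the four adjacent corner regions. Splicing a marked vertex $m$ of $D$ means: $D^m_\infty$ is obtained by the smoothing that merges the two corner regions containing the ends of the marker, $D^m_0$ by the other smoothing. Applying the $\infty$-smoothing (resp. the $0$-smoothing) at all marked vertices gives the positive resolution $L_+(D)$ (resp. negative resolution $L_-(D)$). $D$ is admissible if both $L_+(D)$ and $L_-(D)$ are diagrams of trivial links. $\mathcal{F}$ is the set of admissible marked graph diagrams. The function $P_M$. It is defined (recursively, on all marked graph diagrams and hence on $\mathcal{F}$) by $P_M(D)=P(D)$ if $D$ has no markers, and $P_M(D)=P_M(D^m_\infty)\bullet P_M(D^m_0)$ for any marked vertex $m$ of $D$; the value is independent of the order in which markers are spliced. Invariance under a move means $P_M(D)=P_M(D')$ whenever $D,D'\in\mathcal{F}$ differ by planar isotopy or by one application of the move. Yoshikawa moves are the moves $\Gamma_1,\Gamma_2,\Gamma_3,\Gamma_4,\Gamma_4',\Gamma_5,\Gamma_6,\Gamma_6',\Gamma_7,\Gamma_8$ (local, in a disc). $\Gamma_1,\Gamma_2,\Gamma_3$: Reidemeister moves I, II, III at classical crossings. $\Gamma_4$ (resp. $\Gamma_4'$): an arc passing over (resp. under) two adjacent edges at a marked vertex is slid across the vertex so as to pass over (resp. under) the other two edges. $\Gamma_5$: a marked vertex (marker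 horizontal or vertical) whose two left-hand edges cross each other once is replaced by the same marked vertex whose two right-hand edges cross each other once, the new crossing being a translate of the old. $\Gamma_6$: a marked vertex two cyclically adjacent edges of which are joined into a small loop bounding an otherwise empty disc, such that the $\infty$-smoothing yields an arc and a separate small circle, is replaced by a simple arc; $\Gamma_6'$: the same with the $0$-smoothing yielding an arc and a circle. $\Gamma_7$: consider 3-tangles with three vertical strand positions; let $V_1$ have one marked vertex in positions 1,2 (position 3 straight) whose $\infty$-smoothing is the identity tangle, and let $W_2$ have one marked vertex in positions 2,3 (position 1 straight) whose $0$-smoothing is the identity tangle; $\Gamma_7$ replaces $V_1$ stacked on $W_2$ by $W_2$ stacked on $V_1$. $\Gamma_8$: consider a horizontal pair of parallel strands crossing a vertical pair of parallel strands in four classical crossings; insert a marked vertex between the two horizontal strands near one end, whose $\infty$-smoothing continues the two strands in parallel, and a marked vertex between the two vertical strands near one end, whose $0$-smoothing continues the two strands in parallel; $\Gamma_8$ replaces the 4-tangle in which the horizontal pair is entirely over the vertical pair by the one in which all four crossings are changed. Each move may be applied in either direction. *)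

theory Defs
  imports Main "HOL-Library.FuncSet"
begin

section \<open>Magmas\<close>

locale entropic_magma =
  fixes mul :: "'a \<Rightarrow> 'a \<Rightarrow> 'a"
  assumes entropic: "mul (mul a b) (mul c d) = mul (mul a c) (mul b d)"

text \<open>Sequences are indexed by the positive integers; the value \<open>a 0\<close> plays no role.\<close>

locale kauffman_bracket_magma = star: entropic_magma star
  for star :: "'a \<Rightarrow> 'a \<Rightarrow> 'a" +
  fixes a :: "nat \<Rightarrow> 'a"
  assumes bracket1: "n \<ge> 1 \<Longrightarrow> star (star (a (n+1)) (a (n+2))) (star (a n) (a (n+1))) = a n"
    and bracket2: "n \<ge> 1 \<Longrightarrow> star (star (a n) (a (n+1))) (star (a (n+1)) (a n)) = a (n+1)"

locale marked_kauffman_bracket_magma =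
  kauffman_bracket_magma star a + bullet: entropic_magma bullet
  for star bullet :: "'a \<Rightarrow> 'a \<Rightarrow> 'a" and a :: "nat \<Rightarrow> 'a"

section \<open>Diagrams in the plane\<close>

text \<open>
  A diagram in the plane is put in general position with respect to the height function and
  cut by horizontal lines into slices containing one elementary piece each; it is written as the
  list of its pieces, from bottom to top. A piece with position \<open>i\<close> has exactly \<open>i\<close> vertical
  strands to its left, and any number of vertical strands to its right.

  \<open>Cup i\<close> is a local minimum (two new strands \<open>i\<close>, \<open>i+1\<close> start), \<open>Cap i\<close> is a local maximum
  (strands \<open>i\<close>, \<open>i+1\<close> end). \<open>Cross i s\<close> is a crossing of the strands \<open>i\<close> and \<open>i+1\<close>, where \<open>s\<close>
  is the slope of the overstrand: \<open>Rising\<close> if it runs from bottom left to top right, \<open>Falling\<close> if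
  it runs from top left to bottom right. \<open>Mark i b\<close> is a marked vertex on the strands \<open>i\<close> and
  \<open>i+1\<close>; its edges leave in the four diagonal directions, and its marker lies in the left and right
  corner regions if \<open>b = Horizontal\<close>, in the upper and lower ones if \<open>b = Vertical\<close>.
\<close>

datatype slope = Rising | Falling

datatype axis = Horizontal | Vertical

datatype piece = Cup nat | Cap nat | Cross nat slope | Mark nat axis

fun opp :: "slope \<Rightarrow> slope" where
  "opp Rising = Falling"
| "opp Falling = Rising"

fun turn :: "axis \<Rightarrow> axis" where
  "turn Horizontal = Vertical"
| "turn Vertical = Horizontal"

fun pos :: "piece \<Rightarrow> nat" where
  "pos (Cup i) = i"
| "pos (Cap i) = i"
| "pos (Cross i s) = i"
| "pos (Mark i b) = i"

text \<open>Numbers of strand ends at the bottom and at the top of a piece.\<close>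

fun ins :: "piece \<Rightarrow> nat" where
  "ins (Cup i) = 0"
| "ins (Cap i) = 2"
| "ins (Cross i s) = 2"
| "ins (Mark i b) = 2"

fun outs :: "piece \<Rightarrow> nat" where
  "outs (Cup i) = 2"
| "outs (Cap i) = 0"
| "outs (Cross i s) = 2"
| "outs (Mark i b) = 2"

fun shift :: "nat \<Rightarrow> piece \<Rightarrow> piece" where
  "shift k (Cup i) = Cup (i + k)"
| "shift k (Cap i) = Cap (i + k)"
| "shift k (Cross i s) = Cross (i + k) s"
| "shift k (Mark i b) = Mark (i + k) b"

fun is_cross :: "piece \<Rightarrow> bool" where
  "is_cross (Cross i s) = True"
| "is_cross _ = False"

fun is_mark :: "piece \<Rightarrow> bool" where
  "is_mark (Mark i b) = True"
| "is_mark _ = False"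

text \<open>\<open>tangle n w m\<close>: the pieces of \<open>w\<close> fit together to a tangle diagram with \<open>n\<close> ends at the
  bottom and \<open>m\<close> ends at the top.\<close>

fun tangle :: "nat \<Rightarrow> piece list \<Rightarrow> nat \<Rightarrow> bool" where
  "tangle n [] m \<longleftrightarrow> n = m"
| "tangle n (g # w) m \<longleftrightarrow> pos g + ins g \<le> n \<and> tangle (n - ins g + outs g) w m"

text \<open>The empty diagram is excluded, since the sequence of a magma starts at 1.\<close>

definition marked_graph_diagram :: "piece list \<Rightarrow> bool" where
  "marked_graph_diagram D \<longleftrightarrow> D \<noteq> [] \<and> tangle 0 D 0"

definition link_diagram :: "piece list \<Rightarrow> bool" where
  "link_diagram D \<longleftrightarrow> marked_graph_diagram D \<and> (\<forall>g \<in> set D. \<not> is_mark g)"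

definition crossingless :: "piece list \<Rightarrow> bool" where
  "crossingless D \<longleftrightarrow> link_diagram D \<and> (\<forall>g \<in> set D. \<not> is_cross g)"

section \<open>Components of crossingless diagrams\<close>

text \<open>The point \<open>(t, j)\<close> is the intersection of the \<open>j\<close>-th strand with the line above the first \<open>t\<close>
  pieces. Two points are adjacent if an arc inside a single slice joins them.\<close>

fun strands :: "nat \<Rightarrow> piece list \<Rightarrow> nat" where
  "strands n [] = n"
| "strands n (g # w) = strands (n - ins g + outs g) w"

definition points :: "piece list \<Rightarrow> (nat \<times> nat) set" where
  "points D = {(t, j). t \<le> length D \<and> j < strands 0 (take t D)}"

inductive adjacent :: "piece list \<Rightarrow> nat \<times> nat \<Rightarrow> nat \<times> nat \<Rightarrow> bool" for D where
  left: "t < length D \<Longrightarrow> j < pos (D ! t) \<Longrightarrow> adjacent D (t, j) (Suc t, j)"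
| right: "t < length D \<Longrightarrow> pos (D ! t) \<le> j \<Longrightarrow>
    adjacent D (t, j + ins (D ! t)) (Suc t, j + outs (D ! t))"
| cup: "t < length D \<Longrightarrow> D ! t = Cup i \<Longrightarrow> adjacent D (Suc t, i) (Suc t, i + 1)"
| cap: "t < length D \<Longrightarrow> D ! t = Cap i \<Longrightarrow> adjacent D (t, i) (t, i + 1)"

definition circles :: "piece list \<Rightarrow> nat" where
  "circles D = card (points D // {(x, y). equivclp (adjacent D) x y})"

section \<open>Local moves and planar isotopy\<close>

text \<open>A local move is given by pairs of tangle diagrams; it replaces one by the other, in either
  direction, inside a rectangle of a diagram.\<close>

definition local_step :: "(piece list \<times> piece list) set \<Rightarrow> piece list \<Rightarrow> piece list \<Rightarrow> bool" where
  "local_step M D D' \<longleftrightarrow>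
     marked_graph_diagram D \<and> marked_graph_diagram D' \<and>
     (\<exists>u v k S T. ((S, T) \<in> M \<or> (T, S) \<in> M) \<and>
        D = u @ map (shift k) S @ v \<and> D' = u @ map (shift k) T @ v)"

text \<open>
  Planar isotopy of diagrams in general position is generated by:
  interchanging the heights of two pieces side by side (\<open>pos h\<close> counts the strands to the left of
  \<open>h\<close> that do not belong to \<open>g\<close>); cancelling a local minimum against a neighbouring local maximum;
  and rotating a crossing or a marked vertex by a right angle at a local minimum or maximum. A
  rotation by a right angle exchanges the two values of the slope and of the axis.
\<close>

definition isotopy_moves :: "(piece list \<times> piece list) set" where
  "isotopy_moves =
     {([g, shift (outs g) h], [shift (ins g) h, g]) | g h. pos g \<le> pos h} \<union>
     {([Cup 0, Cap 1], []), ([Cup 1, Cap 0], [])} \<union>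
     {([Cup 0, Cross 1 s], [Cup 1, Cross 0 (opp s)]) | s. True} \<union>
     {([Cross 1 s, Cap 0], [Cross 0 (opp s), Cap 1]) | s. True} \<union>
     {([Cup 0, Mark 1 b], [Cup 1, Mark 0 (turn b)]) | b. True} \<union>
     {([Mark 1 b, Cap 0], [Mark 0 (turn b), Cap 1]) | b. True}"

definition planar_isotopic :: "piece list \<Rightarrow> piece list \<Rightarrow> bool" where
  "planar_isotopic = (local_step isotopy_moves)\<^sup>*\<^sup>*"

text \<open>The discs in which moves take place are arbitrary, hence the isotopies before and after. In
  particular a move may be rotated.\<close>

definition differ_by :: "(piece list \<times> piece list) set \<Rightarrow> piece list \<Rightarrow> piece list \<Rightarrow> bool" where
  "differ_by M D D' \<longleftrightarrow>
     (\<exists>E E'. planar_isotopic D E \<and> local_step M E E' \<and> planar_isotopic E' D')"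

section \<open>Yoshikawa moves\<close>

datatype yoshikawa =
  Gamma1 | Gamma2 | Gamma3 | Gamma4 | Gamma4' | Gamma5 | Gamma6 | Gamma6' | Gamma7 | Gamma8

text \<open>The strands 0, 1 crossing the strands 2, 3, with the former over the latter if the
  overstrands rise, and under them if the overstrands fall.\<close>

definition pair_crossing :: "slope \<Rightarrow> piece list" where
  "pair_crossing s = [Cross 1 s, Cross 0 s, Cross 2 s, Cross 1 s]"

text \<open>
  In \<open>Gamma3\<close>, \<open>s\<close>, \<open>t\<close>, \<open>u\<close> are the slopes at the crossings of the strands (numbered at the
  bottom) 0 and 1, 0 and 2, 1 and 2; the condition excludes a cyclic overlap.

  A vertical marker is one whose \<open>\<infinity>\<close>-smoothing is the pair of vertical strands; for a horizontal
  marker the \<open>0\<close>-smoothing is. In \<open>Gamma8\<close> the pair of strands 0, 1 (bottom left to top right) plays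
  the role of the horizontal pair, and the pair 2, 3 (bottom right to top left) that of the vertical
  pair; either marked vertex may be at either end of its pair.
\<close>

fun tangles_of :: "yoshikawa \<Rightarrow> (piece list \<times> piece list) set" where
  "tangles_of Gamma1 = {([Cup 1, Cross 0 s, Cap 1], []) | s. True}"
| "tangles_of Gamma2 = {([Cross 0 s, Cross 0 (opp s)], []) | s. True}"
| "tangles_of Gamma3 = {([Cross 0 s, Cross 1 t, Cross 0 u], [Cross 1 u, Cross 0 t, Cross 1 s]) | s t u.
     s = u \<longrightarrow> t = s}"
| "tangles_of Gamma4 = {([Cross 0 Rising, Cross 1 Rising, Mark 0 b],
     [Mark 1 b, Cross 0 Rising, Cross 1 Rising]) | b. True}"
| "tangles_of Gamma4' = {([Cross 0 Falling, Cross 1 Falling, Mark 0 b],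
     [Mark 1 b, Cross 0 Falling, Cross 1 Falling]) | b. True}"
| "tangles_of Gamma5 = {([Cross 0 s, Mark 0 b], [Mark 0 b, Cross 0 s]) | s b. True}"
| "tangles_of Gamma6 = {([Cup 1, Mark 0 Vertical, Cap 1], [])}"
| "tangles_of Gamma6' = {([Cup 1, Mark 0 Horizontal, Cap 1], [])}"
| "tangles_of Gamma7 = {([Mark 1 Horizontal, Mark 0 Vertical], [Mark 0 Vertical, Mark 1 Horizontal])}"
| "tangles_of Gamma8 = {(v @ pair_crossing Rising @ w, v @ pair_crossing Falling @ w) | v w.
     (v, w) \<in> {([Mark 0 Vertical, Mark 2 Horizontal], []),
               ([Mark 0 Vertical], [Mark 0 Horizontal]),
               ([Mark 2 Horizontal], [Mark 2 Vertical]),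
               ([], [Mark 2 Vertical, Mark 0 Horizontal])}}"

section \<open>Smoothings and admissible diagrams\<close>

text \<open>The smoothings at the strands \<open>i\<close>, \<open>i+1\<close>: one merges the regions below and above, leaving
  two vertical strands, the other merges the regions to the left and to the right.\<close>

fun smoothing :: "nat \<Rightarrow> axis \<Rightarrow> piece list" where
  "smoothing i Vertical = []"
| "smoothing i Horizontal = [Cap i, Cup i]"

text \<open>A rising overstrand rotated counterclockwise sweeps out the upper and lower regions, a falling
  one the left and right regions.\<close>

fun cross_0 :: "nat \<Rightarrow> slope \<Rightarrow> piece list" where
  "cross_0 i Rising = smoothing i Vertical"
| "cross_0 i Falling = smoothing i Horizontal"

fun cross_infinity :: "nat \<Rightarrow> slope \<Rightarrow> piece list" where
  "cross_infinity i Rising = smoothing i Horizontal"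
| "cross_infinity i Falling = smoothing i Vertical"

definition mark_infinity :: "nat \<Rightarrow> axis \<Rightarrow> piece list" where
  "mark_infinity i b = smoothing i b"

definition mark_0 :: "nat \<Rightarrow> axis \<Rightarrow> piece list" where
  "mark_0 i b = smoothing i (turn b)"

fun splice_marks :: "(nat \<Rightarrow> axis \<Rightarrow> piece list) \<Rightarrow> piece list \<Rightarrow> piece list" where
  "splice_marks r [] = []"
| "splice_marks r (Mark i b # D) = r i b @ splice_marks r D"
| "splice_marks r (g # D) = g # splice_marks r D"

definition positive_resolution :: "piece list \<Rightarrow> piece list" where
  "positive_resolution = splice_marks mark_infinity"

definition negative_resolution :: "piece list \<Rightarrow> piece list" where
  "negative_resolution = splice_marks mark_0"

definition trivial_link_diagram :: "piece list \<Rightarrow> bool" where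
  "trivial_link_diagram D \<longleftrightarrow> link_diagram D \<and>
     (\<exists>T. crossingless T \<and>
        (local_step (isotopy_moves \<union> tangles_of Gamma1 \<union> tangles_of Gamma2 \<union> tangles_of Gamma3))\<^sup>*\<^sup>* D T)"

definition admissible :: "piece list set" where
  "admissible = {D. marked_graph_diagram D \<and>
     trivial_link_diagram (positive_resolution D) \<and> trivial_link_diagram (negative_resolution D)}"

section \<open>The invariants\<close>

definition is_bracket :: "('a \<Rightarrow> 'a \<Rightarrow> 'a) \<Rightarrow> (nat \<Rightarrow> 'a) \<Rightarrow> (piece list \<Rightarrow> 'a) \<Rightarrow> bool" where
  "is_bracket star a P \<longleftrightarrow>
     P \<in> extensional {D. link_diagram D} \<and>
     (\<forall>D D'. link_diagram D \<and> link_diagram D' \<and>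
        (planar_isotopic D D' \<or> differ_by (tangles_of Gamma2) D D' \<or> differ_by (tangles_of Gamma3) D D') \<longrightarrow>
        P D = P D') \<and>
     (\<forall>D. crossingless D \<longrightarrow> P D = a (circles D)) \<and>
     (\<forall>u i s v. link_diagram (u @ [Cross i s] @ v) \<longrightarrow>
        P (u @ [Cross i s] @ v) = star (P (u @ cross_0 i s @ v)) (P (u @ cross_infinity i s @ v)))"

definition bracket :: "('a \<Rightarrow> 'a \<Rightarrow> 'a) \<Rightarrow> (nat \<Rightarrow> 'a) \<Rightarrow> piece list \<Rightarrow> 'a" where
  "bracket star a = (THE P. is_bracket star a P)"

definition is_marked_bracket ::
  "('a \<Rightarrow> 'a \<Rightarrow> 'a) \<Rightarrow> ('a \<Rightarrow> 'a \<Rightarrow> 'a) \<Rightarrow> (nat \<Rightarrow> 'a) \<Rightarrow> (piece list \<Rightarrow> 'a) \<Rightarrow> bool" where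
  "is_marked_bracket star bullet a P_M \<longleftrightarrow>
     P_M \<in> extensional {D. marked_graph_diagram D} \<and>
     (\<forall>D. link_diagram D \<longrightarrow> P_M D = bracket star a D) \<and>
     (\<forall>u i b v. marked_graph_diagram (u @ [Mark i b] @ v) \<longrightarrow>
        P_M (u @ [Mark i b] @ v) =
          bullet (P_M (u @ mark_infinity i b @ v)) (P_M (u @ mark_0 i b @ v)))"

definition marked_bracket ::
  "('a \<Rightarrow> 'a \<Rightarrow> 'a) \<Rightarrow> ('a \<Rightarrow> 'a \<Rightarrow> 'a) \<Rightarrow> (nat \<Rightarrow> 'a) \<Rightarrow> piece list \<Rightarrow> 'a" where
  "marked_bracket star bullet a = (THE P_M. is_marked_bracket star bullet a P_M)"

definition invariant_under :: "(piece list \<Rightarrow> 'a) \<Rightarrow> yoshikawa \<Rightarrow> bool" where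
  "invariant_under f m \<longleftrightarrow>
     (\<forall>D \<in> admissible. \<forall>D' \<in> admissible.
        planar_isotopic D D' \<or> differ_by (tangles_of m) D D' \<longrightarrow> f D = f D')"

end

theory Submission imports Defs begin

text \<open>
  Conditions (1) and (2) force \<open>a\<close> to be constant: \<open>a\<^sub>1 = a\<^sub>1 \<bullet> a\<^sub>2 = a\<^sub>3 \<bullet> a\<^sub>2 = a\<^sub>2\<close>. With
  \<open>c\<close> the common value and \<open>d = c * c\<close>, the magma axioms give \<open>d * d = c\<close>, and (2), (3) give
  \<open>c \<bullet> c = c\<close>, \<open>d \<bullet> d = d\<close>. Hence every value of the invariant is \<open>c\<close> or \<open>d\<close> according to the
  parity of the number of classical crossings, and \<open>\<Gamma>\<^sub>1\<close> is the only move that changes this parity.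
\<close>

section \<open>Counts of crossings and markers\<close>

definition crossings :: "piece list \<Rightarrow> nat" where
  "crossings D = length (filter is_cross D)"

definition marks :: "piece list \<Rightarrow> nat" where
  "marks D = length (filter is_mark D)"

lemma crossings_simps [simp]:
  "crossings [] = 0"
  "crossings (g # D) = of_bool (is_cross g) + crossings D"
  "crossings (D @ E) = crossings D + crossings E"
  by (auto simp: crossings_def)

lemma marks_simps [simp]:
  "marks [] = 0"
  "marks (g # D) = of_bool (is_mark g) + marks D"
  "marks (D @ E) = marks D + marks E"
  by (auto simp: marks_def)

lemma is_cross_shift [simp]: "is_cross (shift k g) = is_cross g"
  by (cases g) auto

lemma crossings_shift [simp]: "crossings (map (shift k) D) = crossings D"
  by (induction D) auto

lemma smoothing_counts [simp]:
  "crossings (smoothing i b) = 0" "marks (smoothing i b) = 0"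
  by (cases b; simp)+

lemma cross_smoothing:
  "\<exists>b. cross_0 i s = smoothing i b" "\<exists>b. cross_infinity i s = smoothing i b"
  by (cases s; metis cross_0.simps cross_infinity.simps)+

lemma crossings_eq_0: "crossings D = 0 \<longleftrightarrow> (\<forall>g \<in> set D. \<not> is_cross g)"
  by (induction D) auto

lemma marks_eq_0: "marks D = 0 \<longleftrightarrow> (\<forall>g \<in> set D. \<not> is_mark g)"
  by (induction D) auto

lemma link_diagram_iff: "link_diagram D \<longleftrightarrow> marked_graph_diagram D \<and> marks D = 0"
  by (simp add: link_diagram_def marks_eq_0)

lemma crossingless_iff: "crossingless D \<longleftrightarrow> link_diagram D \<and> crossings D = 0"
  by (simp add: crossingless_def crossings_eq_0)

lemma split_at_crossing:
  assumes "crossings D \<noteq> 0"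
  obtains u i s v where "D = u @ [Cross i s] @ v"
proof -
  from assms obtain g where g: "g \<in> set D" "is_cross g"
    by (auto simp: crossings_eq_0)
  then obtain u v where "D = u @ [g] @ v"
    by (auto dest: split_list)
  moreover from g(2) obtain i s where "g = Cross i s"
    by (cases g) auto
  ultimately show thesis using that by blast
qed

lemma split_at_mark:
  assumes "marks D \<noteq> 0"
  obtains u i b v where "D = u @ [Mark i b] @ v"
proof -
  from assms obtain g where g: "g \<in> set D" "is_mark g"
    by (auto simp: marks_eq_0)
  then obtain u v where "D = u @ [g] @ v"
    by (auto dest: split_list)
  moreover from g(2) obtain i b where "g = Mark i b"
    by (cases g) auto
  ultimately show thesis using that by blast
qed

section \<open>Smoothings of diagrams\<close>

text \<open>A smoothing has as many strand ends as the piece it replaces, below and above. Phrasing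
  this for any piece with two ends on each side covers crossings and markers at once.\<close>

lemma tangle_smoothing:
  assumes "ins g = 2" "outs g = 2" "tangle n (u @ [g] @ v) m"
  shows "tangle n (u @ smoothing (pos g) b @ v) m"
  using assms(3)
proof (induction u arbitrary: n)
  case Nil
  then have t: "pos g + 2 \<le> n" "tangle (n - 2 + 2) v m"
    using assms(1,2) by simp_all
  \<comment> \<open>In the form \<open>k + 2\<close> the truncated subtraction in
    \<open>n - 2 + 2\<close> is harmless.\<close>
  then obtain k where "n = k + 2"
    by (metis add.commute le_Suc_ex add.assoc)
  with t show ?case
    by (cases b) simp_all
next
  case (Cons h u)
  then show ?case
    by (simp only: append_Cons tangle.simps)
qed

lemma marked_graph_diagram_smoothing:
  assumes "ins g = 2" "outs g = 2" "marked_graph_diagram (u @ [g] @ v)"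
  shows "marked_graph_diagram (u @ smoothing (pos g) b @ v)"
proof -
  \<comment> \<open>The vertical smoothing is the empty list, so nonemptiness must come from the
    context: a piece with two lower ends cannot stand alone on zero strands.\<close>
  have "u \<noteq> [] \<or> v \<noteq> []"
    using assms by (auto simp: marked_graph_diagram_def)
  then show ?thesis
    using assms tangle_smoothing by (auto simp: marked_graph_diagram_def)
qed

lemma link_diagram_smoothing:
  assumes "link_diagram (u @ [Cross i s] @ v)"
  shows "link_diagram (u @ smoothing i b @ v)"
  using assms marked_graph_diagram_smoothing[of "Cross i s"] by (simp add: link_diagram_iff)

lemma link_diagram_cross_smoothings:
  assumes "link_diagram (u @ [Cross i s] @ v)"
  shows "link_diagram (u @ cross_0 i s @ v)" "link_diagram (u @ cross_infinity i s @ v)"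
proof -
  obtain b b' where "cross_0 i s = smoothing i b" "cross_infinity i s = smoothing i b'"
    using cross_smoothing by blast
  then show "link_diagram (u @ cross_0 i s @ v)" "link_diagram (u @ cross_infinity i s @ v)"
    using link_diagram_smoothing[OF assms] by simp_all
qed

lemma crossings_cross_smoothings [simp]:
  "crossings (cross_0 i s) = 0" "crossings (cross_infinity i s) = 0"
  by (cases s; simp)+

section \<open>Components of a diagram\<close>

text \<open>The first piece sits on zero strands, hence is a local minimum and creates a point. The
  bound is needed because the sequence is controlled only from index 1 on.\<close>

lemma circles_pos:
  assumes "marked_graph_diagram D"
  shows "circles D \<ge> 1"
proof -
  obtain g w where D: "D = g # w"
    using assms by (cases D) (auto simp: marked_graph_diagram_def)
  with assms have "ins g = 0"
    by (auto simp: marked_graph_diagram_def)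
  then obtain i where "g = Cup i"
    by (cases g) auto
  with D have ne: "(1, 0) \<in> points D"
    by (auto simp: points_def)
  \<comment> \<open>Finiteness matters because \<open>card\<close> of an infinite set would be
    0.\<close>
  have "points D \<subseteq> (SIGMA t:{..length D}. {..<strands 0 (take t D)})"
    by (auto simp: points_def)
  then have "finite (points D)"
    by (rule finite_subset) auto
  then have "finite (points D // R)" for R :: "((nat \<times> nat) \<times> (nat \<times> nat)) set"
    unfolding quotient_def by auto
  moreover have "points D // R \<noteq> {}" for R :: "((nat \<times> nat) \<times> (nat \<times> nat)) set"
    using ne by (auto simp: quotient_def)
  ultimately show ?thesis
    by (simp add: circles_def Suc_le_eq card_gt_0_iff)
qed

section \<open>Parity of the crossing number under moves\<close>

text \<open>Crossings add up over concatenation and are unchanged by \<open>shift\<close>, so only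
  the two sides of the local move need comparing.\<close>

lemma even_crossings_local_step:
  assumes "local_step M D D'"
    and "\<And>S T. (S, T) \<in> M \<Longrightarrow> even (crossings S) = even (crossings T)"
  shows "even (crossings D) = even (crossings D')"
  using assms by (fastforce simp: local_step_def)

lemma even_crossings_planar_isotopic:
  assumes "planar_isotopic D D'"
  shows "even (crossings D) = even (crossings D')"
  using assms unfolding planar_isotopic_def
proof (induction rule: rtranclp_induct)
  case (step E F)
  have "even (crossings S) = even (crossings T)" if "(S, T) \<in> isotopy_moves" for S T
    using that by (auto simp: isotopy_moves_def)
  then have "even (crossings E) = even (crossings F)"
    by (rule even_crossings_local_step[OF step.hyps(2)])
  with step.IH show ?case by simp
qed simp

text \<open>\<open>Gamma2\<close> changes the count by two; the other moves allowed here have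
  equally many crossings on both sides.\<close>

lemma even_crossings_differ_by:
  assumes "differ_by (tangles_of m) D D'" "m \<noteq> Gamma1"
  shows "even (crossings D) = even (crossings D')"
proof -
  have "even (crossings S) = even (crossings T)" if "(S, T) \<in> tangles_of m" for S T
    using that assms(2) by (cases m) (auto simp: pair_crossing_def)
  note local = even_crossings_local_step[OF _ this]
  obtain E E' where "planar_isotopic D E" "local_step (tangles_of m) E E'" "planar_isotopic E' D'"
    using assms(1) unfolding differ_by_def by blast
  then show ?thesis
    using even_crossings_planar_isotopic local by simp
qed

section \<open>Uniqueness of the two invariants\<close>

text \<open>Each smoothing removes a crossing, so the recursion determines the value from the
  crossingless diagrams; \<open>extensional\<close> fixes the values elsewhere. Uniqueness is what
  makes the \<open>THE\<close> in \<open>bracket\<close> usable.\<close>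

lemma is_bracket_unique:
  assumes P: "is_bracket star a P" and Q: "is_bracket star a Q"
  shows "P = Q"
proof (rule extensionalityI)
  show "P \<in> extensional {D. link_diagram D}" "Q \<in> extensional {D. link_diagram D}"
    using P Q by (auto simp: is_bracket_def)
  fix D assume "D \<in> {D. link_diagram D}"
  then have "link_diagram D" by simp
  then show "P D = Q D"
  proof (induction "crossings D" arbitrary: D rule: less_induct)
    case less
    show ?case
    proof (cases "crossings D = 0")
      case True
      then show ?thesis
        using P Q less.prems by (simp add: is_bracket_def crossingless_iff)
    next
      case False
      then obtain u i s v where D: "D = u @ [Cross i s] @ v"
        by (rule split_at_crossing)
      note l = link_diagram_cross_smoothings[OF less.prems[unfolded D]]
      have "P (u @ cross_0 i s @ v) = Q (u @ cross_0 i s @ v)"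
        by (rule less.hyps[OF _ l(1)]) (simp add: D)
      moreover have "P (u @ cross_infinity i s @ v) = Q (u @ cross_infinity i s @ v)"
        by (rule less.hyps[OF _ l(2)]) (simp add: D)
      moreover have rec: "R D = star (R (u @ cross_0 i s @ v)) (R (u @ cross_infinity i s @ v))"
        if "is_bracket star a R" for R
        using that less.prems unfolding D is_bracket_def by blast
      ultimately show ?thesis
        by (simp add: rec[OF P] rec[OF Q])
    qed
  qed
qed

text \<open>The same induction, now on markers; the base case is the prescribed value on link
  diagrams.\<close>

lemma is_marked_bracket_unique:
  assumes P: "is_marked_bracket star bullet a P" and Q: "is_marked_bracket star bullet a Q"
  shows "P = Q"
proof (rule extensionalityI)
  show "P \<in> extensional {D. marked_graph_diagram D}" "Q \<in> extensional {D. marked_graph_diagram D}"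
    using P Q by (auto simp: is_marked_bracket_def)
  fix D assume "D \<in> {D. marked_graph_diagram D}"
  then have "marked_graph_diagram D" by simp
  then show "P D = Q D"
  proof (induction "marks D" arbitrary: D rule: less_induct)
    case less
    show ?case
    proof (cases "marks D = 0")
      case True
      then show ?thesis
        using P Q less.prems by (simp add: is_marked_bracket_def link_diagram_iff)
    next
      case False
      then obtain u i b v where D: "D = u @ [Mark i b] @ v"
        by (rule split_at_mark)
      \<comment> \<open>Both resolutions of a marker have the form \<open>smoothing i b'\<close>, so
        one statement serves both.\<close>
      have "P (u @ smoothing i b' @ v) = Q (u @ smoothing i b' @ v)" for b'
        using less.prems marked_graph_diagram_smoothing[of "Mark i b"]
        by (intro less.hyps) (simp_all add: D)
      moreover have rec: "R D = bullet (R (u @ mark_infinity i b @ v)) (R (u @ mark_0 i b @ v))"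
        if "is_marked_bracket star bullet a R" for R
        using that less.prems unfolding D is_marked_bracket_def by blast
      ultimately show ?thesis
        by (simp add: rec[OF P] rec[OF Q] mark_infinity_def mark_0_def)
    qed
  qed
qed

section \<open>Closed forms for a constant sequence\<close>

definition parity_value :: "('a \<Rightarrow> 'a \<Rightarrow> 'a) \<Rightarrow> 'a \<Rightarrow> piece list \<Rightarrow> 'a" where
  "parity_value star c D = (if even (crossings D) then c else star c c)"

text \<open>Both smoothings of a crossing have one crossing fewer, hence equal values, and the
  recursion reduces to \<open>star c c\<close> and to \<open>star (star c c) (star c c) = c\<close>.
  Verifying the axioms gives existence, and uniqueness turns it into an equation.\<close>

lemma bracket_constant:
  assumes "\<And>n. n \<ge> 1 \<Longrightarrow> a n = c" "star (star c c) (star c c) = c"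
  shows "bracket star a = restrict (parity_value star c) {D. link_diagram D}"
    (is "_ = ?P")
proof -
  have "is_bracket star a ?P"
    unfolding is_bracket_def
  proof (intro conjI allI impI)
    fix D D'
    assume "link_diagram D \<and> link_diagram D' \<and> (planar_isotopic D D' \<or>
      differ_by (tangles_of Gamma2) D D' \<or> differ_by (tangles_of Gamma3) D D')"
    then show "?P D = ?P D'"
      using even_crossings_planar_isotopic[of D D'] even_crossings_differ_by[of Gamma2 D D']
        even_crossings_differ_by[of Gamma3 D D'] by (auto simp: parity_value_def)
  next
    fix D assume "crossingless D"
    then show "?P D = a (circles D)"
      using circles_pos assms(1) by (simp add: crossingless_iff link_diagram_iff parity_value_def)
  next
    fix u i s v
    assume l: "link_diagram (u @ [Cross i s] @ v)"
    show "?P (u @ [Cross i s] @ v)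
      = star (?P (u @ cross_0 i s @ v)) (?P (u @ cross_infinity i s @ v))"
      using l link_diagram_cross_smoothings[OF l] assms(2) by (simp add: parity_value_def)
  qed simp
  note P = this
  show ?thesis
    unfolding bracket_def by (rule the_equality[where P = "is_bracket star a", OF P is_bracket_unique[OF _ P]])
qed

text \<open>Splicing a marker keeps every crossing, so the recursion asks only that \<open>c\<close>
  and \<open>star c c\<close> be idempotent for \<open>bullet\<close>.\<close>

lemma marked_bracket_constant:
  assumes "\<And>n. n \<ge> 1 \<Longrightarrow> a n = c" "star (star c c) (star c c) = c"
    and "bullet c c = c" "bullet (star c c) (star c c) = star c c"
  shows "marked_bracket star bullet a = restrict (parity_value star c) {D. marked_graph_diagram D}"
    (is "_ = ?P")
proof -
  have "is_marked_bracket star bullet a ?P"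
    unfolding is_marked_bracket_def
  proof (intro conjI allI impI)
    fix D assume "link_diagram D"
    moreover have "bracket star a = restrict (parity_value star c) {D. link_diagram D}"
      using assms(1,2) by (rule bracket_constant)
    ultimately show "?P D = bracket star a D"
      by (simp add: link_diagram_iff)
  next
    fix u i b v
    assume m: "marked_graph_diagram (u @ [Mark i b] @ v)"
    then have s: "marked_graph_diagram (u @ smoothing i b' @ v)" for b'
      using marked_graph_diagram_smoothing[of "Mark i b"] by simp
    show "?P (u @ [Mark i b] @ v)
      = bullet (?P (u @ mark_infinity i b @ v)) (?P (u @ mark_0 i b @ v))"
      using m s assms(3,4) by (simp add: parity_value_def mark_infinity_def mark_0_def)
  qed simp
  note P = this
  show ?thesis
    unfolding marked_bracket_def
    by (rule the_equality[where P = "is_marked_bracket star bullet a", OF P is_marked_bracket_unique[OF _ P]])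
qed

theorem theorem4p2:
  fixes star bullet :: "'a \<Rightarrow> 'a \<Rightarrow> 'a" and a :: "nat \<Rightarrow> 'a"
  assumes "marked_kauffman_bracket_magma star bullet a"
    and "\<And>n. n \<ge> 1 \<Longrightarrow> a n = a (n + 2)"
    and "\<And>n. n \<ge> 1 \<Longrightarrow> bullet (a (n + 1)) (a n) = a n \<and> a n = bullet (a n) (a (n + 1))"
    and "\<And>w x y z. bullet (star w x) (star y z) = star (bullet w y) (bullet x z)"
  shows "\<forall>m. m \<noteq> Gamma1 \<longrightarrow> invariant_under (marked_bracket star bullet a) m"
proof -
  interpret marked_kauffman_bracket_magma star bullet a by fact
  have step: "a (n + 1) = a n" if n: "n \<ge> 1" for n
  proof -
    have "a n = bullet (a n) (a (n + 1))"
      using assms(3)[OF n] by blast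
    also have "\<dots> = bullet (a (n + 2)) (a (n + 1))"
      using assms(2)[OF n] by metis
    \<comment> \<open>This is the first equation of condition (2) at index
      \<open>n + 1\<close>.\<close>
    also have "\<dots> = a (n + 1)"
      using assms(3)[of "n + 1"] by (metis le_add2 add.assoc one_add_one)
    finally show ?thesis by (rule sym)
  qed
  have const: "a n = a 1" if "n \<ge> 1" for n
    using that
  proof (induction rule: dec_induct)
    case (step n)
    then show ?case
      using \<open>\<And>n. n \<ge> 1 \<Longrightarrow> a (n + 1) = a n\<close>[of n] by simp
  qed simp
  \<comment> \<open>The first bracket axiom at index 1, with all entries equal to
    \<open>a 1\<close>.\<close>
  have c: "star (star (a 1) (a 1)) (star (a 1) (a 1)) = a 1"
    using bracket1[of 1] const[of "1 + 1"] const[of "1 + 2"] by simp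
  have b: "bullet (a 1) (a 1) = a 1"
    using assms(3)[of 1] step[of 1] by (metis order_refl)
  \<comment> \<open>Condition (3) moves \<open>bullet\<close> inside, where \<open>a 1\<close> is
    idempotent.\<close>
  have d: "bullet (star (a 1) (a 1)) (star (a 1) (a 1)) = star (a 1) (a 1)"
    by (simp only: assms(4) b)
  have "marked_bracket star bullet a = restrict (parity_value star (a 1)) {D. marked_graph_diagram D}"
    using const c b d by (rule marked_bracket_constant)
  \<comment> \<open>Admissible diagrams are marked graph diagrams, so \<open>restrict\<close>
    returns the parity value on both sides.\<close>
  then show ?thesis
    using even_crossings_planar_isotopic even_crossings_differ_by
    unfolding invariant_under_def
    by (simp add: parity_value_def admissible_def)
qed

end
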